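(* Let $T\subset\mathbb{R}^d$ be compact, $X=(X(t),t\in T)$ a real-valued centered Gaussian random field with continuous sample paths and covariance $R_X(s,t)$, and $\xi:[0,1]\to T$ continuous. Assume the set of $H\in\mathcal{L}$ with $E[X(\xi(v))H]\ge1$ for all $0\le v\le1$ is nonempty, let $C_X(\xi)=\inf\{EH^2: H\in\mathcal{L},\ E[X(\xi(v))H]\ge1\ \forall v\in[0,1]\}$, and let $H_\xi$ be the unique element of this feasible set attaining the infimum. Let $\mathcal{W}_\xi$ be the set of $\mu\in M_1^+([0,1])$ minimizing $\int_0^1\int_0^1R_X(\xi(u),\xi(v))\mu(du)\mu(dv)$. (i) For every $\mu\in\mathcal{W}_\xi$, $H_\xi=C_X(\xi)\int_0^1X(\xi(v))\,\mu(dv)$ with probability 1. (ii) A probability measure $\mu\in M_1^+([0,1])$ belongs to $\mathcal{W}_\xi$ if and only if $$\min_{0\le v\le1}\int_0^1R_X(\xi(u),\xi(v))\,\mu(du)=\int_0^1\!\!\int_0^1R_X(\xi(u_1),\xi(u_2))\,\mu(du_1)\mu(du_2)>0.$$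
   Context: $\mathcal{L}$ is the closure in $L^2(P)$ of finite linear combinations of values $X(t)$, $t\in T$. $M_1^+([0,1])$ denotes Borel probability measures on $[0,1]$. (Under the nonemptiness assumption, the minimization problem defining $C_X(\xi)$ has a unique minimizer, denoted $H_\xi$.) *)

theory Defs
  imports "HOL-Probability.Probability"
begin

definition centered_gaussian :: "'w measure \<Rightarrow> ('w \<Rightarrow> real) \<Rightarrow> bool" where
  "centered_gaussian M Y \<longleftrightarrow> Y \<in> borel_measurable M \<and>
     ((\<exists>\<sigma>>0. distributed M lborel Y (\<lambda>x. ennreal (normal_density 0 \<sigma> x)))
      \<or> (AE \<omega> in M. Y \<omega> = 0))"

text \<open>Centered Gaussian random field indexed by T: all finite linear combinations are
  centered Gaussian (equivalently, all finite-dimensional distributions are centered Gaussian).\<close>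
definition centered_gaussian_field :: "'w measure \<Rightarrow> 't set \<Rightarrow> ('t \<Rightarrow> 'w \<Rightarrow> real) \<Rightarrow> bool" where
  "centered_gaussian_field M T X \<longleftrightarrow>
     (\<forall>F c. finite F \<longrightarrow> F \<subseteq> T \<longrightarrow> centered_gaussian M (\<lambda>\<omega>. \<Sum>t\<in>F. c t * X t \<omega>))"

definition covR :: "'w measure \<Rightarrow> ('t \<Rightarrow> 'w \<Rightarrow> real) \<Rightarrow> 't \<Rightarrow> 't \<Rightarrow> real" where
  "covR M X s t = (\<integral>\<omega>. X s \<omega> * X t \<omega> \<partial>M)"

text \<open>The closure in L^2(P) of finite linear combinations of X(t), t in T
  (represented by square-integrable functions, elements of L^2 identified up to a.e. equality).\<close>
definition L2span :: "'w measure \<Rightarrow> 't set \<Rightarrow> ('t \<Rightarrow> 'w \<Rightarrow> real) \<Rightarrow> ('w \<Rightarrow> real) set" where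
  "L2span M T X = {H. H \<in> borel_measurable M \<and> integrable M (\<lambda>\<omega>. (H \<omega>)\<^sup>2) \<and>
     (\<forall>\<epsilon>>0. \<exists>F c. finite F \<and> F \<subseteq> T \<and>
        (\<integral>\<omega>. (H \<omega> - (\<Sum>t\<in>F. c t * X t \<omega>))\<^sup>2 \<partial>M) < \<epsilon>)}"

definition feasible :: "'w measure \<Rightarrow> 't set \<Rightarrow> ('t \<Rightarrow> 'w \<Rightarrow> real) \<Rightarrow> (real \<Rightarrow> 't) \<Rightarrow> ('w \<Rightarrow> real) set" where
  "feasible M T X \<xi> = {H \<in> L2span M T X. \<forall>v\<in>{0..1}. (\<integral>\<omega>. X (\<xi> v) \<omega> * H \<omega> \<partial>M) \<ge> 1}"

definition CX :: "'w measure \<Rightarrow> 't set \<Rightarrow> ('t \<Rightarrow> 'w \<Rightarrow> real) \<Rightarrow> (real \<Rightarrow> 't) \<Rightarrow> real" where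
  "CX M T X \<xi> = Inf ((\<lambda>H. \<integral>\<omega>. (H \<omega>)\<^sup>2 \<partial>M) ` feasible M T X \<xi>)"

definition prob_measures_01 :: "real measure set" where
  "prob_measures_01 = {\<mu>. prob_space \<mu> \<and> sets \<mu> = sets (restrict_space borel {0..1})}"

definition energy :: "'w measure \<Rightarrow> ('t \<Rightarrow> 'w \<Rightarrow> real) \<Rightarrow> (real \<Rightarrow> 't) \<Rightarrow> real measure \<Rightarrow> real" where
  "energy M X \<xi> \<mu> = (\<integral>u. (\<integral>v. covR M X (\<xi> u) (\<xi> v) \<partial>\<mu>) \<partial>\<mu>)"

definition W_set :: "'w measure \<Rightarrow> ('t \<Rightarrow> 'w \<Rightarrow> real) \<Rightarrow> (real \<Rightarrow> 't) \<Rightarrow> real measure set" where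
  "W_set M X \<xi> = {\<mu> \<in> prob_measures_01. \<forall>\<nu>\<in>prob_measures_01. energy M X \<xi> \<mu> \<le> energy M X \<xi> \<nu>}"

end

theory Submission
  imports Defs
begin

text \<open>
  For a probability measure \<open>\<mu>\<close> put \<open>Z \<mu> = \<integral> X (\<xi> v) d\<mu>\<close>, which lies in the Gaussian Hilbert
  space as an \<open>L\<^sup>2\<close> limit of Riemann sums. By Fubini, \<open>E (X (\<xi> v) * Z \<mu>)\<close> is the potential of \<open>\<mu>\<close>
  at \<open>v\<close>, the energy of \<open>\<mu>\<close> is \<open>e = E (Z \<mu>)\<^sup>2\<close>, and \<open>E (H * Z \<mu>) \<ge> 1\<close> for every feasible \<open>H\<close>;
  the last fact forces \<open>e > 0\<close>. If \<open>\<mu>\<close> minimizes the energy, perturbing it towards point masses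
  shows that its potential is at least \<open>e\<close>, so \<open>Z \<mu> / e\<close> is feasible, hence \<open>C * e \<le> 1\<close>, and
  \<open>E (H - C * Z \<mu>)\<^sup>2 \<le> C - 2 * C + C\<^sup>2 * e \<le> 0\<close>. Conversely, if the potential is at least \<open>e\<close>, then
  \<open>E (Z \<nu> * Z \<mu>) \<ge> E (Z \<mu>)\<^sup>2\<close>, so \<open>0 \<le> E (Z \<nu> - Z \<mu>)\<^sup>2\<close> gives \<open>E (Z \<nu>)\<^sup>2 \<ge> e\<close>.
\<close>

section \<open>Second moments and cosine expectations of centered Gaussian variables\<close>

text \<open>The cosine is the real part of \<open>iexp\<close>, so this is read off the known
  characteristic function.\<close>

lemma std_normal_cos_expectation:
  "(\<integral>x. cos (s * x) \<partial>std_normal_distribution) = exp (- s\<^sup>2 / 2)"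
proof -
  interpret real_distribution std_normal_distribution
    by (rule real_dist_normal_dist)
  have "Re (char std_normal_distribution s) = (\<integral>x. Re (iexp (s * x)) \<partial>std_normal_distribution)"
    unfolding char_def by (rule integral_Re[symmetric], rule integrable_iexp) simp_all
  then show ?thesis
    by (simp add: char_std_normal_distribution Re_exp)
qed

text \<open>The second identity recovers the second moment from the expectation of a bounded
  function, which makes limits of covariances accessible to dominated convergence. A variable
  vanishing almost surely fits the same formula, both sides being 1.\<close>

lemma (in prob_space) centered_gaussian_moments:
  assumes "centered_gaussian M Y"
  shows "integrable M (\<lambda>\<omega>. (Y \<omega>)\<^sup>2)"
    and "(\<integral>\<omega>. cos (Y \<omega>) \<partial>M) = exp (- (\<integral>\<omega>. (Y \<omega>)\<^sup>2 \<partial>M) / 2)"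
proof -
  have Y[measurable]: "Y \<in> borel_measurable M"
    using assms by (simp add: centered_gaussian_def)
  have "integrable M (\<lambda>\<omega>. (Y \<omega>)\<^sup>2) \<and>
        (\<integral>\<omega>. cos (Y \<omega>) \<partial>M) = exp (- (\<integral>\<omega>. (Y \<omega>)\<^sup>2 \<partial>M) / 2)"
  proof (cases "\<exists>\<sigma>>0. distributed M lborel Y (\<lambda>x. ennreal (normal_density 0 \<sigma> x))")
    case True
    then obtain \<sigma> where \<sigma>: "\<sigma> > 0"
      and D: "distributed M lborel Y (\<lambda>x. ennreal (normal_density 0 \<sigma> x))" by blast
    have D1: "distributed M lborel (\<lambda>\<omega>. Y \<omega> / \<sigma>) (\<lambda>x. ennreal (std_normal_density x))"
      using normal_standard_normal_convert[OF \<sigma>, of Y 0] D by simp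
    have "distr M lborel (\<lambda>\<omega>. Y \<omega> / \<sigma>) = std_normal_distribution"
      using distributed_distr_eq_density[OF D1] by simp
    then have "(\<integral>x. cos (\<sigma> * x) \<partial>std_normal_distribution) = (\<integral>\<omega>. cos (\<sigma> * (Y \<omega> / \<sigma>)) \<partial>M)"
      using integral_distr[of "\<lambda>\<omega>. Y \<omega> / \<sigma>" M lborel "\<lambda>x. cos (\<sigma> * x)"] by simp
    then have c: "(\<integral>\<omega>. cos (Y \<omega>) \<partial>M) = exp (- \<sigma>\<^sup>2 / 2)"
      using \<sigma> by (simp add: std_normal_cos_expectation)
    have v: "(\<integral>\<omega>. (Y \<omega>)\<^sup>2 \<partial>M) = \<sigma>\<^sup>2"
      using normal_distributed_variance[OF \<sigma> D] normal_distributed_expectation[OF \<sigma> D] by simp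
    \<comment> \<open>A non-integrable function has integral 0 by convention, whereas
      \<open>v\<close> gives the nonzero value \<open>\<sigma>\<^sup>2\<close>.\<close>
    have "integrable M (\<lambda>\<omega>. (Y \<omega>)\<^sup>2)"
      using not_integrable_integral_eq v \<sigma> by fastforce
    with c v show ?thesis by simp
  next
    case False
    then have 0: "AE \<omega> in M. Y \<omega> = 0"
      using assms by (auto simp: centered_gaussian_def)
    have "integrable M (\<lambda>\<omega>. (Y \<omega>)\<^sup>2) \<longleftrightarrow> integrable M (\<lambda>\<omega>. 0::real)"
      using 0 by (intro integrable_cong_AE) auto
    moreover have "(\<integral>\<omega>. (Y \<omega>)\<^sup>2 \<partial>M) = (\<integral>\<omega>. 0 \<partial>M)"
      using 0 by (intro integral_cong_AE) auto
    moreover have "(\<integral>\<omega>. cos (Y \<omega>) \<partial>M) = (\<integral>\<omega>. 1 \<partial>M)"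
      using 0 by (intro integral_cong_AE) auto
    ultimately show ?thesis by (simp add: prob_space)
  qed
  then show "integrable M (\<lambda>\<omega>. (Y \<omega>)\<^sup>2)"
    and "(\<integral>\<omega>. cos (Y \<omega>) \<partial>M) = exp (- (\<integral>\<omega>. (Y \<omega>)\<^sup>2 \<partial>M) / 2)" by auto
qed

section \<open>Quadratic estimates for square-integrable functions\<close>

lemma abs_mult_le_sum_squares: "\<bar>a * b\<bar> \<le> a\<^sup>2 + (b::real)\<^sup>2"
proof -
  have "2 * (\<bar>a\<bar> * \<bar>b\<bar>) \<le> a\<^sup>2 + b\<^sup>2" using sum_squares_bound[of "\<bar>a\<bar>" "\<bar>b\<bar>"] by simp
  moreover have "0 \<le> \<bar>a\<bar> * \<bar>b\<bar>" by simp
  ultimately show ?thesis unfolding abs_mult by linarith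
qed

lemma integrable_mult_of_squares:
  fixes f g :: "'a \<Rightarrow> real"
  assumes [measurable]: "f \<in> borel_measurable M" "g \<in> borel_measurable M"
    and "integrable M (\<lambda>x. (f x)\<^sup>2)" "integrable M (\<lambda>x. (g x)\<^sup>2)"
  shows "integrable M (\<lambda>x. f x * g x)"
proof (rule Bochner_Integration.integrable_bound)
  show "integrable M (\<lambda>x. (f x)\<^sup>2 + (g x)\<^sup>2)" using assms by simp
  show "AE x in M. norm (f x * g x) \<le> norm ((f x)\<^sup>2 + (g x)\<^sup>2)"
    using abs_mult_le_sum_squares by (intro AE_I2) simp
qed simp

text \<open>The Hilbert space identity behind all later quadratic arguments. The free coefficient
  \<open>c\<close> serves as perturbation size, as the multiple of an average subtracted from
  \<open>H\<close>, and as \<open>1\<close> or \<open>-1\<close> for differences and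
  polarization.\<close>

lemma square_diff_expand:
  fixes f g :: "'a \<Rightarrow> real"
  assumes [measurable]: "f \<in> borel_measurable M" "g \<in> borel_measurable M"
    and i: "integrable M (\<lambda>x. (f x)\<^sup>2)" "integrable M (\<lambda>x. (g x)\<^sup>2)"
  shows "integrable M (\<lambda>x. (f x - c * g x)\<^sup>2)"
    and "(\<integral>x. (f x - c * g x)\<^sup>2 \<partial>M) =
      (\<integral>x. (f x)\<^sup>2 \<partial>M) - 2 * c * (\<integral>x. f x * g x \<partial>M) + c\<^sup>2 * (\<integral>x. (g x)\<^sup>2 \<partial>M)"
proof -
  note fg = integrable_mult_of_squares[OF assms]
  have eq: "(\<lambda>x. (f x - c * g x)\<^sup>2) = (\<lambda>x. (f x)\<^sup>2 - 2 * c * (f x * g x) + c\<^sup>2 * (g x)\<^sup>2)"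
    by (auto simp: power2_eq_square algebra_simps)
  show "integrable M (\<lambda>x. (f x - c * g x)\<^sup>2)"
    unfolding eq using fg i by simp
  show "(\<integral>x. (f x - c * g x)\<^sup>2 \<partial>M) =
      (\<integral>x. (f x)\<^sup>2 \<partial>M) - 2 * c * (\<integral>x. f x * g x \<partial>M) + c\<^sup>2 * (\<integral>x. (g x)\<^sup>2 \<partial>M)"
    unfolding eq using fg i by simp
qed

text \<open>Jensen's inequality for the square: the variance, expanded around the mean
  \<open>?m\<close>, is nonnegative.\<close>

lemma (in prob_space) square_integral_le:
  fixes f :: "'a \<Rightarrow> real"
  assumes "f \<in> borel_measurable M" "integrable M (\<lambda>x. (f x)\<^sup>2)"
  shows "(\<integral>x. f x \<partial>M)\<^sup>2 \<le> (\<integral>x. (f x)\<^sup>2 \<partial>M)"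
proof -
  let ?m = "\<integral>x. f x \<partial>M"
  have "0 \<le> (\<integral>x. (f x - ?m * 1)\<^sup>2 \<partial>M)" by simp
  also have "\<dots> = (\<integral>x. (f x)\<^sup>2 \<partial>M) - 2 * ?m * ?m + ?m\<^sup>2"
    using square_diff_expand(2)[of f M "\<lambda>_. 1" ?m] assms by (simp add: prob_space)
  finally show ?thesis by (simp add: power2_eq_square)
qed

lemma continuous_on_compact_abs_bounded:
  fixes f :: "'a::topological_space \<Rightarrow> real"
  assumes "continuous_on S f" "compact S"
  obtains B where "\<And>x. x \<in> S \<Longrightarrow> \<bar>f x\<bar> \<le> B"
proof -
  obtain B where "\<forall>y\<in>f ` S. norm y \<le> B"
    using compact_imp_bounded[OF compact_continuous_image[OF assms]] unfolding bounded_iff by blast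
  then show ?thesis using that[of B] by simp
qed

section \<open>Probability measures on the unit interval and mixtures with point masses\<close>

lemma prob_measures_01D:
  assumes "\<mu> \<in> prob_measures_01"
  shows "prob_space \<mu>" "sets \<mu> = sets (restrict_space borel {0..1})" "space \<mu> = {0..1}"
proof -
  show "prob_space \<mu>" and s: "sets \<mu> = sets (restrict_space borel {0..1})"
    using assms by (auto simp: prob_measures_01_def)
  show "space \<mu> = {0..1}"
    using sets_eq_imp_space_eq[OF s] by (simp add: space_restrict_space)
qed

lemma borel_measurable_prob_measures_01:
  assumes "\<mu> \<in> prob_measures_01" "f \<in> borel_measurable borel"
  shows "f \<in> borel_measurable \<mu>"
  unfolding measurable_cong_sets[OF prob_measures_01D(2)[OF assms(1)] refl]
  using assms(2) by (rule measurable_restrict_space1)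

text \<open>This is the convex combination of the point mass at \<open>v\<close>, with weight
  \<open>t\<close>, and \<open>\<mu>\<close>, with weight \<open>1 - t\<close>. It is encoded as the
  law of a random choice: a coin with bias \<open>t\<close> decides between \<open>v\<close> and a
  sample from \<open>\<mu>\<close>. As an image of a product measure it is a probability measure at
  once.\<close>

definition point_mixture :: "real \<Rightarrow> real \<Rightarrow> real measure \<Rightarrow> real measure" where
  "point_mixture t v \<mu> =
     distr (measure_pmf (bernoulli_pmf t) \<Otimes>\<^sub>M \<mu>) (restrict_space borel {0..1})
       (\<lambda>(b, u). if b then v else u)"

lemma
  assumes \<mu>: "\<mu> \<in> prob_measures_01" and v: "v \<in> {0..1}" and t: "0 \<le> t" "t \<le> 1"
  shows point_mixture_prob: "point_mixture t v \<mu> \<in> prob_measures_01"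
    and integral_point_mixture: "continuous_on {0..1} f \<Longrightarrow>
      (\<integral>u. f u \<partial>point_mixture t v \<mu>) = t * f v + (1 - t) * (\<integral>u. (f u :: real) \<partial>\<mu>)"
proof -
  let ?N = "restrict_space borel {0..1::real}" and ?B = "measure_pmf (bernoulli_pmf t)"
  interpret \<mu>: prob_space \<mu> using prob_measures_01D(1)[OF \<mu>] .
  interpret P: pair_prob_space ?B \<mu> ..
  have [measurable_cong]: "sets \<mu> = sets ?N" by (rule prob_measures_01D(2)[OF \<mu>])
  have vN: "v \<in> space ?N" using v by (simp add: space_restrict_space)
  have m[measurable]: "(\<lambda>(b, u). if b then v else u) \<in> measurable (?B \<Otimes>\<^sub>M \<mu>) ?N"
    using vN by measurable
  show "point_mixture t v \<mu> \<in> prob_measures_01"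
    unfolding prob_measures_01_def point_mixture_def using P.prob_space_distr[OF m] by simp
  assume f: "continuous_on {0..1} f"
  have [measurable]: "f \<in> borel_measurable ?N"
    by (rule borel_measurable_continuous_on_restrict[OF f])
  obtain B where B: "\<And>u. u \<in> {0..1} \<Longrightarrow> \<bar>f u\<bar> \<le> B"
    using continuous_on_compact_abs_bounded[OF f compact_Icc] by blast
  \<comment> \<open>Continuity on the compact interval bounds \<open>f\<close>, which justifies
    Fubini; integrating out the coin then leaves a sum of two terms.\<close>
  have int: "integrable (?B \<Otimes>\<^sub>M \<mu>) (\<lambda>(b, u). f (if b then v else u))"
    by (rule P.integrable_const_bound[where B=B])
      (use B v in \<open>auto simp: space_pair_measure prob_measures_01D(3)[OF \<mu>]\<close>)
  have "(\<integral>u. f u \<partial>point_mixture t v \<mu>) = (\<integral>x. f (case x of (b, u) \<Rightarrow> if b then v else u) \<partial>(?B \<Otimes>\<^sub>M \<mu>))"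
    unfolding point_mixture_def by (rule integral_distr) measurable
  also have "\<dots> = (\<integral>b. (\<integral>u. f (if b then v else u) \<partial>\<mu>) \<partial>?B)"
    using P.integral_fst'[OF int] by (simp add: case_prod_unfold cong: if_cong)
  also have "\<dots> = t * f v + (1 - t) * (\<integral>u. f u \<partial>\<mu>)"
    using t by (simp add: \<mu>.prob_space)
  finally show "(\<integral>u. f u \<partial>point_mixture t v \<mu>) = t * f v + (1 - t) * (\<integral>u. f u \<partial>\<mu>)" .
qed

section \<open>Discretization of the unit interval\<close>

text \<open>Rounding down keeps points of \<open>{0..1}\<close> inside \<open>{0..1}\<close>, and
  \<open>Suc n\<close> avoids division by zero at \<open>n = 0\<close>.\<close>

definition grid_floor :: "nat \<Rightarrow> real \<Rightarrow> real" where
  "grid_floor n u = of_int \<lfloor>real (Suc n) * u\<rfloor> / real (Suc n)"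

lemma grid_floor_bounds: "u - 1 / real (Suc n) \<le> grid_floor n u" "grid_floor n u \<le> u"
proof -
  have "real (Suc n) * u - 1 \<le> of_int \<lfloor>real (Suc n) * u\<rfloor>" by linarith
  then show "u - 1 / real (Suc n) \<le> grid_floor n u"
    unfolding grid_floor_def by (simp add: le_divide_eq right_diff_distrib mult.commute del: of_nat_Suc)
  have "of_int \<lfloor>real (Suc n) * u\<rfloor> \<le> real (Suc n) * u" by linarith
  then show "grid_floor n u \<le> u"
    unfolding grid_floor_def by (simp add: divide_le_eq mult.commute)
qed

lemma grid_floor_in: "u \<in> {0..1} \<Longrightarrow> grid_floor n u \<in> {0..1}"
  using order.trans[OF grid_floor_bounds(2)[of n u], of 1]
  unfolding atLeastAtMost_iff by (intro conjI) (simp_all add: grid_floor_def)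

lemma grid_floor_tendsto: "(\<lambda>n. grid_floor n u) \<longlonglongrightarrow> u"
proof (rule tendsto_sandwich[where h = "\<lambda>_. u"])
  show "(\<lambda>n. u - 1 / real (Suc n)) \<longlonglongrightarrow> u"
    using tendsto_diff[OF tendsto_const LIMSEQ_inverse_real_of_nat, of u]
    by (simp add: inverse_eq_divide)
qed (intro always_eventually allI grid_floor_bounds tendsto_const)+

lemma finite_grid_floor: "finite (grid_floor n ` {0..1})"
proof (rule finite_subset)
  \<comment> \<open>The upper end \<open>Suc n\<close> is included because \<open>u = 1\<close> is
    itself a grid point.\<close>
  show "grid_floor n ` {0..1} \<subseteq> (\<lambda>i. of_int i / real (Suc n)) ` {0..int (Suc n)}"
  proof clarify
    fix u :: real assume u: "u \<in> {0..1}"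
    have "real (Suc n) * u \<le> real (Suc n)" using u by (intro mult_left_le) auto
    then have "\<lfloor>real (Suc n) * u\<rfloor> \<le> int (Suc n)" by linarith
    then have "\<lfloor>real (Suc n) * u\<rfloor> \<in> {0..int (Suc n)}"
      using u by simp
    then show "grid_floor n u \<in> (\<lambda>i. of_int i / real (Suc n)) ` {0..int (Suc n)}"
      unfolding grid_floor_def by blast
  qed
qed simp

lemma borel_measurable_grid_floor [measurable]: "grid_floor n \<in> borel_measurable borel"
  unfolding grid_floor_def[abs_def] by measurable

section \<open>Averages of a process with continuous paths and continuous covariance\<close>

text \<open>Two kinds of continuity are kept apart. Continuity of paths gives joint measurability
  and pathwise integrals; continuity of the covariance gives uniform second moment bounds and L^2
  convergence of Riemann sums.\<close>

locale mean_square_process = prob_space M for M :: "'w measure" +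
  fixes Y :: "real \<Rightarrow> 'w \<Rightarrow> real"
  assumes Y_measurable: "v \<in> {0..1} \<Longrightarrow> Y v \<in> borel_measurable M"
    and Y_continuous: "\<omega> \<in> space M \<Longrightarrow> continuous_on {0..1} (\<lambda>v. Y v \<omega>)"
    and Y_square_integrable: "v \<in> {0..1} \<Longrightarrow> integrable M (\<lambda>\<omega>. (Y v \<omega>)\<^sup>2)"
    and cov_continuous: "continuous_on ({0..1} \<times> {0..1}) (\<lambda>(u, v). \<integral>\<omega>. Y u \<omega> * Y v \<omega> \<partial>M)"
begin

text \<open>The variable called \<open>Z \<mu>\<close> in the overview.\<close>

definition average :: "real measure \<Rightarrow> 'w \<Rightarrow> real" where
  "average \<mu> \<omega> = (\<integral>v. Y v \<omega> \<partial>\<mu>)"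

lemma cov_bounded:
  obtains B where "\<And>u v. u \<in> {0..1} \<Longrightarrow> v \<in> {0..1} \<Longrightarrow> \<bar>\<integral>\<omega>. Y u \<omega> * Y v \<omega> \<partial>M\<bar> \<le> B"
proof -
  obtain B where B: "\<And>x. x \<in> {0..1} \<times> {0..1} \<Longrightarrow> \<bar>case x of (u, v) \<Rightarrow> \<integral>\<omega>. Y u \<omega> * Y v \<omega> \<partial>M\<bar> \<le> B"
    using continuous_on_compact_abs_bounded[OF cov_continuous compact_Times[OF compact_Icc compact_Icc]] by blast
  show ?thesis
  proof (rule that)
    fix u v :: real assume "u \<in> {0..1}" "v \<in> {0..1}"
    then show "\<bar>\<integral>\<omega>. Y u \<omega> * Y v \<omega> \<partial>M\<bar> \<le> B" using B[of "(u, v)"] by simp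
  qed
qed

text \<open>Separates the variables: each summand is a function of \<open>u\<close> times a function
  of \<open>\<omega>\<close>. This yields joint measurability and turns the integral over
  \<open>u\<close> into a finite sum.\<close>

lemma grid_sum:
  assumes "u \<in> {0..1}"
  shows "Y (grid_floor n u) \<omega> =
    (\<Sum>r\<in>grid_floor n ` {0..1}. indicator {x. grid_floor n x = r} u * Y r \<omega>)"
proof -
  have "(\<Sum>r\<in>grid_floor n ` {0..1}. indicator {x. grid_floor n x = r} u * Y r \<omega>) =
        (\<Sum>r\<in>grid_floor n ` {0..1}. if grid_floor n u = r then Y r \<omega> else 0)"
    by (intro sum.cong) (auto simp: indicator_def)
  then show ?thesis using assms finite_grid_floor by simp
qed

lemma Y_grid_jointly_measurable:
  assumes \<mu>: "\<mu> \<in> prob_measures_01"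
  shows "(\<lambda>(u, \<omega>). Y (grid_floor n u) \<omega>) \<in> borel_measurable (\<mu> \<Otimes>\<^sub>M M)"
proof -
  have [measurable]: "grid_floor n \<in> borel_measurable \<mu>"
    by (intro borel_measurable_prob_measures_01[OF \<mu>] borel_measurable_grid_floor)
  have "(\<lambda>x. \<Sum>r\<in>grid_floor n ` {0..1}. indicator {x. grid_floor n x = r} (fst x) * Y r (snd x))
     \<in> borel_measurable (\<mu> \<Otimes>\<^sub>M M)"
  proof (rule borel_measurable_sum)
    fix r assume "r \<in> grid_floor n ` {0..1}"
    then have [measurable]: "Y r \<in> borel_measurable M"
      using Y_measurable grid_floor_in by auto
    have "(\<lambda>x. (if grid_floor n (fst x) = r then 1 else 0) * Y r (snd x)) \<in> borel_measurable (\<mu> \<Otimes>\<^sub>M M)"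
      by measurable
    then show "(\<lambda>x. indicator {x. grid_floor n x = r} (fst x) * Y r (snd x)) \<in> borel_measurable (\<mu> \<Otimes>\<^sub>M M)"
      by (simp add: indicator_def)
  qed
  then show ?thesis
    by (rule measurable_cong[THEN iffD2, rotated])
      (auto simp: space_pair_measure prob_measures_01D(3)[OF \<mu>] grid_sum)
qed

text \<open>By continuity of paths the process is the pointwise limit of its grid versions, which
  are jointly measurable.\<close>

lemma Y_jointly_measurable:
  assumes \<mu>: "\<mu> \<in> prob_measures_01"
  shows "(\<lambda>(u, \<omega>). Y u \<omega>) \<in> borel_measurable (\<mu> \<Otimes>\<^sub>M M)"
proof (rule borel_measurable_LIMSEQ_real)
  fix x assume x: "x \<in> space (\<mu> \<Otimes>\<^sub>M M)"
  obtain u \<omega> where [simp]: "x = (u, \<omega>)" by (cases x)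
  from x have u: "u \<in> {0..1}" and \<omega>: "\<omega> \<in> space M"
    by (auto simp: space_pair_measure prob_measures_01D(3)[OF \<mu>])
  have "(\<lambda>n. Y (grid_floor n u) \<omega>) \<longlonglongrightarrow> Y u \<omega>"
    by (rule continuous_on_tendsto_compose[OF Y_continuous[OF \<omega>] grid_floor_tendsto u])
      (use grid_floor_in[OF u] in auto)
  then show "(\<lambda>n. (\<lambda>(u, \<omega>). Y (grid_floor n u) \<omega>) x) \<longlonglongrightarrow> (\<lambda>(u, \<omega>). Y u \<omega>) x" by simp
qed (rule Y_grid_jointly_measurable[OF \<mu>])

lemma Y_path_measurable:
  assumes "\<mu> \<in> prob_measures_01" "\<omega> \<in> space M"
  shows "(\<lambda>v. Y v \<omega>) \<in> borel_measurable \<mu>"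
  unfolding measurable_cong_sets[OF prob_measures_01D(2)[OF assms(1)] refl]
  by (rule borel_measurable_continuous_on_restrict[OF Y_continuous[OF assms(2)]])

lemma path_bounded:
  assumes "\<omega> \<in> space M"
  obtains B where "\<And>u. u \<in> {0..1} \<Longrightarrow> \<bar>Y u \<omega>\<bar> \<le> B"
  using continuous_on_compact_abs_bounded[OF Y_continuous[OF assms] compact_Icc] by blast

lemma average_measurable:
  assumes \<mu>: "\<mu> \<in> prob_measures_01"
  shows "average \<mu> \<in> borel_measurable M"
proof -
  interpret \<mu>: prob_space \<mu> using prob_measures_01D(1)[OF \<mu>] .
  have "(\<lambda>(\<omega>, u). Y u \<omega>) \<in> borel_measurable (M \<Otimes>\<^sub>M \<mu>)"
    using measurable_pair_swap[OF Y_jointly_measurable[OF \<mu>]] by simp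
  then show ?thesis
    unfolding average_def[abs_def] by (rule \<mu>.borel_measurable_lebesgue_integral)
qed

text \<open>Jensen's inequality on each path bounds the squared average by the average of
  \<open>(Y u \<omega>)\<^sup>2\<close>, which is integrable by Fubini because the variances are
  bounded uniformly in \<open>u\<close>.\<close>

lemma average_square_integrable:
  assumes \<mu>: "\<mu> \<in> prob_measures_01"
  shows "integrable M (\<lambda>\<omega>. (average \<mu> \<omega>)\<^sup>2)"
proof -
  interpret \<mu>: prob_space \<mu> using prob_measures_01D(1)[OF \<mu>] .
  interpret P: pair_prob_space \<mu> M ..
  note [measurable] = Y_jointly_measurable[OF \<mu>] average_measurable[OF \<mu>]
  obtain B where B: "\<And>u v. u \<in> {0..1} \<Longrightarrow> v \<in> {0..1} \<Longrightarrow> \<bar>\<integral>\<omega>. Y u \<omega> * Y v \<omega> \<partial>M\<bar> \<le> B"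
    using cov_bounded by blast
  have "integrable (\<mu> \<Otimes>\<^sub>M M) (\<lambda>(u, \<omega>). (Y u \<omega>)\<^sup>2)"
  proof (rule P.Fubini_integrable)
    show "integrable \<mu> (\<lambda>u. \<integral>\<omega>. norm (case (u, \<omega>) of (u, \<omega>) \<Rightarrow> (Y u \<omega>)\<^sup>2) \<partial>M)"
      by (rule \<mu>.integrable_const_bound[where B=B])
        (use B in \<open>auto intro!: AE_I2 abs_le_D1[OF B] simp: prob_measures_01D(3)[OF \<mu>] power2_eq_square\<close>)
    show "AE u in \<mu>. integrable M (\<lambda>\<omega>. case (u, \<omega>) of (u, \<omega>) \<Rightarrow> (Y u \<omega>)\<^sup>2)"
      using Y_square_integrable by (auto simp: prob_measures_01D(3)[OF \<mu>])
  qed measurable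
  then have "integrable M (\<lambda>\<omega>. \<integral>u. (Y u \<omega>)\<^sup>2 \<partial>\<mu>)"
    by (rule P.integrable_snd)
  then show ?thesis
  proof (rule Bochner_Integration.integrable_bound)
    show "AE \<omega> in M. norm ((average \<mu> \<omega>)\<^sup>2) \<le> norm (\<integral>u. (Y u \<omega>)\<^sup>2 \<partial>\<mu>)"
    proof (rule AE_I2)
      fix \<omega> assume \<omega>: "\<omega> \<in> space M"
      note m[measurable] = Y_path_measurable[OF \<mu> \<omega>]
      obtain b where b: "\<And>u. u \<in> {0..1} \<Longrightarrow> \<bar>Y u \<omega>\<bar> \<le> b" using path_bounded[OF \<omega>] by blast
      have "integrable \<mu> (\<lambda>u. (Y u \<omega>)\<^sup>2)"
      proof (rule \<mu>.integrable_const_bound[where B="b\<^sup>2"])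
        show "AE u in \<mu>. norm ((Y u \<omega>)\<^sup>2) \<le> b\<^sup>2"
        proof (rule AE_I2)
          fix u assume "u \<in> space \<mu>"
          then have "\<bar>Y u \<omega>\<bar> \<le> b" using b prob_measures_01D(3)[OF \<mu>] by blast
          then show "norm ((Y u \<omega>)\<^sup>2) \<le> b\<^sup>2" using abs_le_square_iff[of "Y u \<omega>" b] by auto
        qed
      qed measurable
      then show "norm ((average \<mu> \<omega>)\<^sup>2) \<le> norm (\<integral>u. (Y u \<omega>)\<^sup>2 \<partial>\<mu>)"
        using \<mu>.square_integral_le[OF m] unfolding average_def by simp
    qed
  qed measurable
qed

text \<open>Fubini, with absolute integrability coming from the bound of a product by the sum of the
  squares. Taking \<open>h\<close> to be a value of the process, another average, or a feasible
  element gives potentials, energies and the pairing with the constraints.\<close>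

lemma integral_average_mult:
  assumes \<mu>: "\<mu> \<in> prob_measures_01"
    and h[measurable]: "h \<in> borel_measurable M" and hi: "integrable M (\<lambda>\<omega>. (h \<omega>)\<^sup>2)"
  shows "integrable \<mu> (\<lambda>v. \<integral>\<omega>. Y v \<omega> * h \<omega> \<partial>M)"
    and "(\<integral>\<omega>. average \<mu> \<omega> * h \<omega> \<partial>M) = (\<integral>v. (\<integral>\<omega>. Y v \<omega> * h \<omega> \<partial>M) \<partial>\<mu>)"
proof -
  interpret \<mu>: prob_space \<mu> using prob_measures_01D(1)[OF \<mu>] .
  interpret P: pair_prob_space \<mu> M ..
  note [measurable] = Y_jointly_measurable[OF \<mu>] average_measurable[OF \<mu>]
  obtain B where B: "\<And>u v. u \<in> {0..1} \<Longrightarrow> v \<in> {0..1} \<Longrightarrow> \<bar>\<integral>\<omega>. Y u \<omega> * Y v \<omega> \<partial>M\<bar> \<le> B"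
    using cov_bounded by blast
  have int: "integrable M (\<lambda>\<omega>. Y u \<omega> * h \<omega>)" if "u \<in> {0..1}" for u
    using that by (intro integrable_mult_of_squares Y_measurable Y_square_integrable h hi)
  have Pint: "integrable (\<mu> \<Otimes>\<^sub>M M) (\<lambda>(u, \<omega>). Y u \<omega> * h \<omega>)"
  proof (rule P.Fubini_integrable)
    show "integrable \<mu> (\<lambda>u. \<integral>\<omega>. norm (case (u, \<omega>) of (u, \<omega>) \<Rightarrow> Y u \<omega> * h \<omega>) \<partial>M)"
    proof (rule \<mu>.integrable_const_bound[where B="B + (\<integral>\<omega>. (h \<omega>)\<^sup>2 \<partial>M)"])
      show "AE u in \<mu>. norm (\<integral>\<omega>. norm (case (u, \<omega>) of (u, \<omega>) \<Rightarrow> Y u \<omega> * h \<omega>) \<partial>M)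
              \<le> B + (\<integral>\<omega>. (h \<omega>)\<^sup>2 \<partial>M)"
      proof (rule AE_I2)
        fix u assume "u \<in> space \<mu>"
        then have u: "u \<in> {0..1}" using prob_measures_01D(3)[OF \<mu>] by simp
        have "(\<integral>\<omega>. norm (Y u \<omega> * h \<omega>) \<partial>M) \<le> (\<integral>\<omega>. (Y u \<omega>)\<^sup>2 + (h \<omega>)\<^sup>2 \<partial>M)"
        proof (rule integral_mono)
          show "norm (Y u \<omega> * h \<omega>) \<le> (Y u \<omega>)\<^sup>2 + (h \<omega>)\<^sup>2" for \<omega>
            using abs_mult_le_sum_squares by simp
        qed (use int[OF u] Y_square_integrable[OF u] hi in auto)
        also have "\<dots> \<le> B + (\<integral>\<omega>. (h \<omega>)\<^sup>2 \<partial>M)"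
          using B[OF u u] Y_square_integrable[OF u] hi by (simp add: power2_eq_square)
        finally show "norm (\<integral>\<omega>. norm (case (u, \<omega>) of (u, \<omega>) \<Rightarrow> Y u \<omega> * h \<omega>) \<partial>M)
              \<le> B + (\<integral>\<omega>. (h \<omega>)\<^sup>2 \<partial>M)" by simp
      qed
    qed measurable
    show "AE u in \<mu>. integrable M (\<lambda>\<omega>. case (u, \<omega>) of (u, \<omega>) \<Rightarrow> Y u \<omega> * h \<omega>)"
      using int by (auto simp: prob_measures_01D(3)[OF \<mu>])
  qed measurable
  show "integrable \<mu> (\<lambda>v. \<integral>\<omega>. Y v \<omega> * h \<omega> \<partial>M)"
    using P.integrable_fst[OF Pint] by simp
  have "(\<integral>\<omega>. average \<mu> \<omega> * h \<omega> \<partial>M) = (\<integral>\<omega>. (\<integral>v. Y v \<omega> * h \<omega> \<partial>\<mu>) \<partial>M)"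
    unfolding average_def by simp
  also have "\<dots> = (\<integral>v. (\<integral>\<omega>. Y v \<omega> * h \<omega> \<partial>M) \<partial>\<mu>)"
    by (rule P.Fubini_integral[OF Pint])
  finally show "(\<integral>\<omega>. average \<mu> \<omega> * h \<omega> \<partial>M) = (\<integral>v. (\<integral>\<omega>. Y v \<omega> * h \<omega> \<partial>M) \<partial>\<mu>)" .
qed

text \<open>Identifies the discretized average as a Riemann sum weighted by the
  \<open>\<mu>\<close>-masses of the grid cells, hence as a finite linear combination of values of
  the process.\<close>

lemma average_grid:
  assumes \<mu>: "\<mu> \<in> prob_measures_01"
  shows "(\<integral>u. Y (grid_floor n u) \<omega> \<partial>\<mu>) =
    (\<Sum>r\<in>grid_floor n ` {0..1}. measure \<mu> {u \<in> space \<mu>. grid_floor n u = r} * Y r \<omega>)"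
proof -
  interpret \<mu>: prob_space \<mu> using prob_measures_01D(1)[OF \<mu>] .
  have [measurable]: "grid_floor n \<in> borel_measurable \<mu>"
    by (intro borel_measurable_prob_measures_01[OF \<mu>] borel_measurable_grid_floor)
  let ?A = "\<lambda>r. {u \<in> space \<mu>. grid_floor n u = r}"
  have [measurable]: "?A r \<in> sets \<mu>" for r by measurable
  have "(\<integral>u. Y (grid_floor n u) \<omega> \<partial>\<mu>) =
        (\<integral>u. (\<Sum>r\<in>grid_floor n ` {0..1}. indicator (?A r) u * Y r \<omega>) \<partial>\<mu>)"
    by (intro Bochner_Integration.integral_cong refl)
      (subst grid_sum, auto simp: prob_measures_01D(3)[OF \<mu>] indicator_def intro!: sum.cong)
  also have "\<dots> = (\<Sum>r\<in>grid_floor n ` {0..1}. \<integral>u. indicator (?A r) u * Y r \<omega> \<partial>\<mu>)"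
    by (intro Bochner_Integration.integral_sum integrable_mult_left integrable_real_indicator)
      (auto simp: \<mu>.emeasure_eq_measure)
  also have "\<dots> = (\<Sum>r\<in>grid_floor n ` {0..1}. measure \<mu> (?A r) * Y r \<omega>)"
    by (intro sum.cong) auto
  finally show ?thesis .
qed

text \<open>The error is written in covariances alone, so that their bound and their continuity
  apply directly.\<close>

lemma grid_mean_square_error:
  assumes u: "u \<in> {0..1}"
  shows "integrable M (\<lambda>\<omega>. (Y u \<omega> - Y (grid_floor n u) \<omega>)\<^sup>2)"
    and "(\<integral>\<omega>. (Y u \<omega> - Y (grid_floor n u) \<omega>)\<^sup>2 \<partial>M) =
      (\<integral>\<omega>. Y u \<omega> * Y u \<omega> \<partial>M) - 2 * (\<integral>\<omega>. Y u \<omega> * Y (grid_floor n u) \<omega> \<partial>M)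
      + (\<integral>\<omega>. Y (grid_floor n u) \<omega> * Y (grid_floor n u) \<omega> \<partial>M)"
proof -
  note g = grid_floor_in[OF u, of n]
  note * = square_diff_expand[OF Y_measurable[OF u] Y_measurable[OF g]
      Y_square_integrable[OF u] Y_square_integrable[OF g], of 1]
  show "integrable M (\<lambda>\<omega>. (Y u \<omega> - Y (grid_floor n u) \<omega>)\<^sup>2)" using *(1) by simp
  show "(\<integral>\<omega>. (Y u \<omega> - Y (grid_floor n u) \<omega>)\<^sup>2 \<partial>M) =
      (\<integral>\<omega>. Y u \<omega> * Y u \<omega> \<partial>M) - 2 * (\<integral>\<omega>. Y u \<omega> * Y (grid_floor n u) \<omega> \<partial>M)
      + (\<integral>\<omega>. Y (grid_floor n u) \<omega> * Y (grid_floor n u) \<omega> \<partial>M)"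
    using *(2) by (simp add: power2_eq_square)
qed

text \<open>Jensen and Fubini bound the L^2 error by the \<open>\<mu>\<close>-integral of the
  pointwise mean-square errors \<open>D n u\<close>. These tend to 0 by continuity of the covariance
  at \<open>(u, u)\<close>, and dominated convergence concludes.\<close>

lemma grid_average_tendsto:
  assumes \<mu>: "\<mu> \<in> prob_measures_01"
  shows "(\<lambda>n. \<integral>\<omega>. (average \<mu> \<omega> - (\<integral>u. Y (grid_floor n u) \<omega> \<partial>\<mu>))\<^sup>2 \<partial>M) \<longlonglongrightarrow> 0"
proof -
  interpret \<mu>: prob_space \<mu> using prob_measures_01D(1)[OF \<mu>] .
  interpret P: pair_prob_space \<mu> M ..
  note [measurable] = Y_jointly_measurable[OF \<mu>] Y_grid_jointly_measurable[OF \<mu>]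
  obtain B where B: "\<And>u v. u \<in> {0..1} \<Longrightarrow> v \<in> {0..1} \<Longrightarrow> \<bar>\<integral>\<omega>. Y u \<omega> * Y v \<omega> \<partial>M\<bar> \<le> B"
    using cov_bounded by blast
  define D where "D n u = (\<integral>\<omega>. (Y u \<omega> - Y (grid_floor n u) \<omega>)\<^sup>2 \<partial>M)" for n u
  have Dm[measurable]: "D n \<in> borel_measurable \<mu>" for n
    unfolding D_def[abs_def] by measurable
  \<comment> \<open>The three covariances in the expansion of the error carry coefficients 1, 2 and
    1 in absolute value, whence the factor 4.\<close>
  have Dbound: "\<bar>D n u\<bar> \<le> 4 * B" if u: "u \<in> {0..1}" for n u
    unfolding D_def grid_mean_square_error(2)[OF u]
    using B[OF u u] B[OF u grid_floor_in[OF u, of n]]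
      B[OF grid_floor_in[OF u, of n] grid_floor_in[OF u, of n]]
    by linarith
  have Dlim: "(\<lambda>n. D n u) \<longlonglongrightarrow> 0" if u: "u \<in> {0..1}" for u
  proof -
    let ?K = "\<lambda>(u, v). \<integral>\<omega>. Y u \<omega> * Y v \<omega> \<partial>M"
    have K: "(\<lambda>n. ?K (a n, b n)) \<longlonglongrightarrow> ?K (u, u)"
      if "a \<longlonglongrightarrow> u" "b \<longlonglongrightarrow> u" "\<And>n. a n \<in> {0..1}" "\<And>n. b n \<in> {0..1}" for a b
      by (rule continuous_on_tendsto_compose[OF cov_continuous tendsto_Pair[OF that(1,2)]])
        (use u that in auto)
    have "(\<lambda>n. ?K (u, u) - 2 * ?K (u, grid_floor n u) + ?K (grid_floor n u, grid_floor n u))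
        \<longlonglongrightarrow> ?K (u, u) - 2 * ?K (u, u) + ?K (u, u)"
      by (intro tendsto_intros K grid_floor_tendsto grid_floor_in u)
    then show ?thesis unfolding D_def grid_mean_square_error(2)[OF u] by simp
  qed
  have "(\<lambda>n. \<integral>u. D n u \<partial>\<mu>) \<longlonglongrightarrow> (\<integral>u. 0 \<partial>\<mu>)"
    by (rule integral_dominated_convergence[where w="\<lambda>_. 4 * B"])
      (use Dlim Dbound in \<open>auto intro!: AE_I2 simp: prob_measures_01D(3)[OF \<mu>]\<close>)
  then have lim: "(\<lambda>n. \<integral>u. D n u \<partial>\<mu>) \<longlonglongrightarrow> 0" by simp
  have le: "(\<integral>\<omega>. (average \<mu> \<omega> - (\<integral>u. Y (grid_floor n u) \<omega> \<partial>\<mu>))\<^sup>2 \<partial>M) \<le> (\<integral>u. D n u \<partial>\<mu>)" for n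
  proof -
    have Pint: "integrable (\<mu> \<Otimes>\<^sub>M M) (\<lambda>(u, \<omega>). (Y u \<omega> - Y (grid_floor n u) \<omega>)\<^sup>2)"
    proof (rule P.Fubini_integrable)
      show "integrable \<mu> (\<lambda>u. \<integral>\<omega>. norm (case (u, \<omega>) of (u, \<omega>) \<Rightarrow> (Y u \<omega> - Y (grid_floor n u) \<omega>)\<^sup>2) \<partial>M)"
        by (rule \<mu>.integrable_const_bound[where B="4 * B"])
          (use Dm[of n] Dbound[of _ n] in \<open>auto intro!: AE_I2 simp: prob_measures_01D(3)[OF \<mu>] D_def[symmetric]\<close>)
      show "AE u in \<mu>. integrable M (\<lambda>\<omega>. case (u, \<omega>) of (u, \<omega>) \<Rightarrow> (Y u \<omega> - Y (grid_floor n u) \<omega>)\<^sup>2)"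
        using grid_mean_square_error(1) by (auto simp: prob_measures_01D(3)[OF \<mu>])
    qed measurable
    have "(\<integral>\<omega>. (average \<mu> \<omega> - (\<integral>u. Y (grid_floor n u) \<omega> \<partial>\<mu>))\<^sup>2 \<partial>M)
        \<le> (\<integral>\<omega>. (\<integral>u. (Y u \<omega> - Y (grid_floor n u) \<omega>)\<^sup>2 \<partial>\<mu>) \<partial>M)"
    proof (rule integral_mono')
      show "integrable M (\<lambda>\<omega>. \<integral>u. (Y u \<omega> - Y (grid_floor n u) \<omega>)\<^sup>2 \<partial>\<mu>)"
        using P.integrable_snd[OF Pint] by simp
      fix \<omega> assume \<omega>: "\<omega> \<in> space M"
      note [measurable] = Y_path_measurable[OF \<mu> \<omega>]
      have [measurable]: "(\<lambda>u. Y (grid_floor n u) \<omega>) \<in> borel_measurable \<mu>"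
        using measurable_compose[OF measurable_Pair2'[OF \<omega>, of \<mu>] Y_grid_jointly_measurable[OF \<mu>, of n]]
        by simp
      obtain b where b: "\<And>u. u \<in> {0..1} \<Longrightarrow> \<bar>Y u \<omega>\<bar> \<le> b" using path_bounded[OF \<omega>] by blast
      have i1: "integrable \<mu> (\<lambda>u. Y u \<omega>)"
        by (rule \<mu>.integrable_const_bound[where B=b])
          (use b in \<open>auto simp: prob_measures_01D(3)[OF \<mu>]\<close>)
      have i2: "integrable \<mu> (\<lambda>u. Y (grid_floor n u) \<omega>)"
        by (rule \<mu>.integrable_const_bound[where B=b])
          (use b[OF grid_floor_in] in \<open>auto simp: prob_measures_01D(3)[OF \<mu>]\<close>)
      have i3: "integrable \<mu> (\<lambda>u. (Y u \<omega> - Y (grid_floor n u) \<omega>)\<^sup>2)"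
      proof (rule \<mu>.integrable_const_bound[where B="(2 * b)\<^sup>2"])
        show "AE u in \<mu>. norm ((Y u \<omega> - Y (grid_floor n u) \<omega>)\<^sup>2) \<le> (2 * b)\<^sup>2"
        proof (rule AE_I2)
          fix u assume "u \<in> space \<mu>"
          then have u: "u \<in> {0..1}" using prob_measures_01D(3)[OF \<mu>] by blast
          have "\<bar>Y u \<omega> - Y (grid_floor n u) \<omega>\<bar> \<le> \<bar>2 * b\<bar>"
            using b[OF u] b[OF grid_floor_in[OF u, of n]] by linarith
          then show "norm ((Y u \<omega> - Y (grid_floor n u) \<omega>)\<^sup>2) \<le> (2 * b)\<^sup>2"
            by (simp only: abs_le_square_iff real_norm_def abs_power2)
        qed
      qed measurable
      have "average \<mu> \<omega> - (\<integral>u. Y (grid_floor n u) \<omega> \<partial>\<mu>) = (\<integral>u. Y u \<omega> - Y (grid_floor n u) \<omega> \<partial>\<mu>)"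
        unfolding average_def using i1 i2 by simp
      then show "(average \<mu> \<omega> - (\<integral>u. Y (grid_floor n u) \<omega> \<partial>\<mu>))\<^sup>2
          \<le> (\<integral>u. (Y u \<omega> - Y (grid_floor n u) \<omega>)\<^sup>2 \<partial>\<mu>)"
        using \<mu>.square_integral_le[OF _ i3] by simp
    qed simp
    also have "\<dots> = (\<integral>u. D n u \<partial>\<mu>)"
      unfolding D_def using P.Fubini_integral[OF Pint] by simp
    finally show ?thesis .
  qed
  show ?thesis
    by (rule tendsto_sandwich[OF _ _ tendsto_const lim]) (use le in auto)
qed

section \<open>Energy as a squared norm and its first variation\<close>

lemma average_point_mixture:
  assumes "\<mu> \<in> prob_measures_01" "v \<in> {0..1}" "0 \<le> t" "t \<le> 1" "\<omega> \<in> space M"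
  shows "average (point_mixture t v \<mu>) \<omega> = average \<mu> \<omega> - t * (average \<mu> \<omega> - Y v \<omega>)"
  unfolding average_def integral_point_mixture[OF assms(1-4) Y_continuous[OF assms(5)]]
  by (simp add: algebra_simps)

text \<open>Two applications of \<open>integral_average_mult\<close>: the inner integral with
  \<open>h\<close> a value of the process, the outer one with \<open>h\<close> the average
  itself.\<close>

lemma double_integral_cov:
  assumes \<mu>: "\<mu> \<in> prob_measures_01"
  shows "(\<integral>u. (\<integral>v. (\<integral>\<omega>. Y u \<omega> * Y v \<omega> \<partial>M) \<partial>\<mu>) \<partial>\<mu>) = (\<integral>\<omega>. (average \<mu> \<omega>)\<^sup>2 \<partial>M)"
proof -
  have "(\<integral>u. (\<integral>v. (\<integral>\<omega>. Y u \<omega> * Y v \<omega> \<partial>M) \<partial>\<mu>) \<partial>\<mu>) = (\<integral>u. (\<integral>\<omega>. Y u \<omega> * average \<mu> \<omega> \<partial>M) \<partial>\<mu>)"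
  proof (rule Bochner_Integration.integral_cong[OF refl])
    fix u assume "u \<in> space \<mu>"
    then have u: "u \<in> {0..1}" using prob_measures_01D(3)[OF \<mu>] by simp
    show "(\<integral>v. (\<integral>\<omega>. Y u \<omega> * Y v \<omega> \<partial>M) \<partial>\<mu>) = (\<integral>\<omega>. Y u \<omega> * average \<mu> \<omega> \<partial>M)"
      using integral_average_mult(2)[OF \<mu> Y_measurable[OF u] Y_square_integrable[OF u]]
      by (simp add: mult.commute)
  qed
  then show ?thesis
    using integral_average_mult(2)[OF \<mu> average_measurable[OF \<mu>] average_square_integrable[OF \<mu>]]
    by (simp add: power2_eq_square)
qed

text \<open>First-order optimality of \<open>\<mu>\<close> in the direction of the point mass at \<open>v\<close>.\<close>
lemma minimal_average_inner:
  assumes \<mu>: "\<mu> \<in> prob_measures_01" and v: "v \<in> {0..1}"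
    and min: "\<And>\<nu>. \<nu> \<in> prob_measures_01 \<Longrightarrow>
      (\<integral>\<omega>. (average \<mu> \<omega>)\<^sup>2 \<partial>M) \<le> (\<integral>\<omega>. (average \<nu> \<omega>)\<^sup>2 \<partial>M)"
  shows "(\<integral>\<omega>. (average \<mu> \<omega>)\<^sup>2 \<partial>M) \<le> (\<integral>\<omega>. average \<mu> \<omega> * Y v \<omega> \<partial>M)"
proof (rule ccontr)
  assume neg: "\<not> ?thesis"
  \<comment> \<open>Moving from \<open>\<mu>\<close> towards the point mass at \<open>v\<close>
    subtracts multiples of \<open>g\<close> from the average, so \<open>2 * a\<close> is the initial
    rate of decrease of the energy. It is positive under the negated goal.\<close>
  define g where "g \<omega> = average \<mu> \<omega> - Y v \<omega>" for \<omega>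
  define a where "a = (\<integral>\<omega>. average \<mu> \<omega> * g \<omega> \<partial>M)"
  define b where "b = (\<integral>\<omega>. (g \<omega>)\<^sup>2 \<partial>M)"
  note Zm[measurable] = average_measurable[OF \<mu>] and Zi = average_square_integrable[OF \<mu>]
  note Ym[measurable] = Y_measurable[OF v] and Yi = Y_square_integrable[OF v]
  have gm[measurable]: "g \<in> borel_measurable M" unfolding g_def[abs_def] by measurable
  have gi: "integrable M (\<lambda>\<omega>. (g \<omega>)\<^sup>2)"
    using square_diff_expand(1)[OF Zm Ym Zi Yi, of 1] by (simp add: g_def)
  have "a = (\<integral>\<omega>. (average \<mu> \<omega>)\<^sup>2 - average \<mu> \<omega> * Y v \<omega> \<partial>M)"
    unfolding a_def g_def by (simp add: power2_eq_square algebra_simps)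
  also have "\<dots> = (\<integral>\<omega>. (average \<mu> \<omega>)\<^sup>2 \<partial>M) - (\<integral>\<omega>. average \<mu> \<omega> * Y v \<omega> \<partial>M)"
    using Zi integrable_mult_of_squares[OF Zm Ym Zi Yi] by simp
  finally have a: "a > 0" using neg by simp
  have b: "b \<ge> 0" unfolding b_def by simp
  \<comment> \<open>Minimality will give \<open>2 * a \<le> t * b\<close>, while this
    \<open>t\<close> makes \<open>t * b \<le> a\<close>. The minimum with 1 keeps the mixture a
    probability measure, and \<open>b + 1\<close> avoids division by zero.\<close>
  define t where "t = min 1 (a / (b + 1))"
  have t: "0 < t" "t \<le> 1" using a b by (auto simp: t_def)
  have "(\<integral>\<omega>. (average \<mu> \<omega>)\<^sup>2 \<partial>M) \<le> (\<integral>\<omega>. (average (point_mixture t v \<mu>) \<omega>)\<^sup>2 \<partial>M)"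
    using t by (intro min point_mixture_prob \<mu> v) auto
  also have "\<dots> = (\<integral>\<omega>. (average \<mu> \<omega> - t * g \<omega>)\<^sup>2 \<partial>M)"
    using t by (intro Bochner_Integration.integral_cong refl)
      (simp add: average_point_mixture[OF \<mu> v] g_def)
  also have "\<dots> = (\<integral>\<omega>. (average \<mu> \<omega>)\<^sup>2 \<partial>M) - 2 * t * a + t\<^sup>2 * b"
    unfolding a_def b_def by (rule square_diff_expand(2)[OF Zm gm Zi gi])
  finally have "t * (2 * a) \<le> t * (t * b)" by (simp add: power2_eq_square algebra_simps)
  then have "2 * a \<le> t * b" using t(1) by simp
  also have "\<dots> \<le> a / (b + 1) * b" using b by (intro mult_right_mono) (auto simp: t_def)
  also have "\<dots> \<le> a" using a b by (simp add: field_simps)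
  finally show False using a by simp
qed

end

section \<open>Gaussian fields along a continuous path\<close>

text \<open>Since \<open>E (cos Y) = exp (- E Y\<^sup>2 / 2)\<close> for centered Gaussian \<open>Y\<close>, dominated convergence for the
  bounded cosine gives continuity of second moments without any uniform integrability.\<close>
lemma (in prob_space) gaussian_covariance_continuous:
  fixes Y :: "'t::metric_space \<Rightarrow> 'a \<Rightarrow> real"
  assumes G: "\<And>u v a b. u \<in> S \<Longrightarrow> v \<in> S \<Longrightarrow> centered_gaussian M (\<lambda>\<omega>. a * Y u \<omega> + b * Y v \<omega>)"
    and C: "\<And>\<omega>. \<omega> \<in> space M \<Longrightarrow> continuous_on S (\<lambda>v. Y v \<omega>)"
  shows "continuous_on (S \<times> S) (\<lambda>(u, v). \<integral>\<omega>. Y u \<omega> * Y v \<omega> \<partial>M)"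
proof -
  \<comment> \<open>The covariance is recovered by polarization from the second moments for
    \<open>b = 1\<close> and \<open>b = - 1\<close>, so it suffices that each \<open>V b\<close> is
    continuous.\<close>
  define V where "V b x = (\<integral>\<omega>. (Y (fst x) \<omega> + b * Y (snd x) \<omega>)\<^sup>2 \<partial>M)" for b and x :: "'t \<times> 't"
  have G1: "centered_gaussian M (\<lambda>\<omega>. Y u \<omega> + b * Y v \<omega>)" if "u \<in> S" "v \<in> S" for u v b
    using G[OF that, of 1 b] by simp
  \<comment> \<open>The cosine expectation is an exponential, hence positive, so its logarithm is
    defined and continuous.\<close>
  have V: "V b x = - 2 * ln (\<integral>\<omega>. cos (Y (fst x) \<omega> + b * Y (snd x) \<omega>) \<partial>M)"
    and pos: "(\<integral>\<omega>. cos (Y (fst x) \<omega> + b * Y (snd x) \<omega>) \<partial>M) > 0"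
    if "x \<in> S \<times> S" for b x
    using that centered_gaussian_moments(2)[OF G1[of "fst x" "snd x" b]] by (auto simp: V_def)
  have cosc: "continuous_on (S \<times> S) (\<lambda>x. \<integral>\<omega>. cos (Y (fst x) \<omega> + b * Y (snd x) \<omega>) \<partial>M)" for b
    unfolding continuous_on_sequentially comp_def
  proof (intro allI ballI impI, elim conjE)
    fix x :: "nat \<Rightarrow> 't \<times> 't" and a
    assume a: "a \<in> S \<times> S" and x: "\<forall>n. x n \<in> S \<times> S" and lim: "x \<longlonglongrightarrow> a"
    have m: "(\<lambda>\<omega>. Y (fst y) \<omega> + b * Y (snd y) \<omega>) \<in> borel_measurable M" if "y \<in> S \<times> S" for y
      using G1[of "fst y" "snd y" b] that by (auto simp: centered_gaussian_def)
    show "(\<lambda>n. \<integral>\<omega>. cos (Y (fst (x n)) \<omega> + b * Y (snd (x n)) \<omega>) \<partial>M)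
      \<longlonglongrightarrow> (\<integral>\<omega>. cos (Y (fst a) \<omega> + b * Y (snd a) \<omega>) \<partial>M)"
    proof (rule integral_dominated_convergence[where w="\<lambda>_. 1"])
      show "AE \<omega> in M. (\<lambda>n. cos (Y (fst (x n)) \<omega> + b * Y (snd (x n)) \<omega>))
          \<longlonglongrightarrow> cos (Y (fst a) \<omega> + b * Y (snd a) \<omega>)"
      proof (rule AE_I2)
        fix \<omega> assume "\<omega> \<in> space M"
        note c = continuous_on_tendsto_compose[OF C[OF this]]
        have "(\<lambda>n. Y (fst (x n)) \<omega>) \<longlonglongrightarrow> Y (fst a) \<omega>"
          by (rule c[OF tendsto_fst[OF lim]]) (use a x in \<open>auto simp: mem_Times_iff\<close>)
        moreover have "(\<lambda>n. Y (snd (x n)) \<omega>) \<longlonglongrightarrow> Y (snd a) \<omega>"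
          by (rule c[OF tendsto_snd[OF lim]]) (use a x in \<open>auto simp: mem_Times_iff\<close>)
        ultimately show "(\<lambda>n. cos (Y (fst (x n)) \<omega> + b * Y (snd (x n)) \<omega>))
          \<longlonglongrightarrow> cos (Y (fst a) \<omega> + b * Y (snd a) \<omega>)"
          by (intro tendsto_intros)
      qed
      show "(\<lambda>\<omega>. cos (Y (fst a) \<omega> + b * Y (snd a) \<omega>)) \<in> borel_measurable M"
        using m[OF a] by measurable
      show "(\<lambda>\<omega>. cos (Y (fst (x n)) \<omega> + b * Y (snd (x n)) \<omega>)) \<in> borel_measurable M" for n
        using m[OF x[rule_format, of n]] by measurable
    qed auto
  qed
  have Vc: "continuous_on (S \<times> S) (V b)" for b
  proof (rule continuous_on_cong[OF refl V, THEN iffD2])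
    show "continuous_on (S \<times> S) (\<lambda>x. - 2 * ln (\<integral>\<omega>. cos (Y (fst x) \<omega> + b * Y (snd x) \<omega>) \<partial>M))"
      by (intro continuous_intros cosc ballI) (metis less_irrefl pos)
  qed
  have pol: "(case x of (u, v) \<Rightarrow> \<integral>\<omega>. Y u \<omega> * Y v \<omega> \<partial>M) = (V 1 x - V (- 1) x) / 4"
    if "x \<in> S \<times> S" for x
  proof -
    obtain u v where x: "x = (u, v)" by (cases x)
    then have u: "u \<in> S" and v: "v \<in> S" using that by auto
    have m: "Y w \<in> borel_measurable M" and i: "integrable M (\<lambda>\<omega>. (Y w \<omega>)\<^sup>2)" if "w \<in> S" for w
      using G[OF that that, of 1 0] centered_gaussian_moments(1)[OF G[OF that that, of 1 0]]
      by (auto simp: centered_gaussian_def)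
    note e = square_diff_expand(2)[OF m[OF u] m[OF v] i[OF u] i[OF v]]
    show ?thesis using e[of 1] e[of "-1"] by (simp add: x V_def)
  qed
  show ?thesis
    by (rule continuous_on_cong[OF refl pol, THEN iffD2]) (auto intro!: continuous_intros Vc)
qed

text \<open>The field is specified by sums over sets of indices, so for \<open>s = t\<close> the two
  coefficients have to be merged into one.\<close>

lemma centered_gaussian_field_pair:
  assumes "centered_gaussian_field M T X" "s \<in> T" "t \<in> T"
  shows "centered_gaussian M (\<lambda>\<omega>. a * X s \<omega> + b * X t \<omega>)"
proof -
  have *: "centered_gaussian M (\<lambda>\<omega>. \<Sum>r\<in>{s, t}. c r * X r \<omega>)" for c
    by (rule assms(1)[unfolded centered_gaussian_field_def, rule_format]) (use assms(2,3) in auto)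
  show ?thesis
  proof (cases "s = t")
    case True
    then show ?thesis using *[of "\<lambda>_. a + b"] by (simp add: distrib_right)
  next
    case False
    then show ?thesis using *[of "\<lambda>r. if r = s then a else b"] by simp
  qed
qed

text \<open>The Gaussian law enters the variational argument here, through second moments and
  continuity of the covariance along \<open>\<xi>\<close>.\<close>

lemma gaussian_field_mean_square_process:
  fixes T :: "'t::metric_space set"
  assumes "prob_space M" and G: "centered_gaussian_field M T X"
    and C: "\<forall>\<omega>\<in>space M. continuous_on T (\<lambda>t. X t \<omega>)"
    and \<xi>: "continuous_on {0..1} \<xi>" "\<xi> ` {0..1} \<subseteq> T"
  shows "mean_square_process M (\<lambda>v. X (\<xi> v))"
proof -
  interpret prob_space M by fact
  have g: "centered_gaussian M (\<lambda>\<omega>. a * X (\<xi> u) \<omega> + b * X (\<xi> v) \<omega>)"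
    if "u \<in> {0..1}" "v \<in> {0..1}" for a b u v
    using that \<xi>(2) by (intro centered_gaussian_field_pair[OF G]) auto
  have c: "continuous_on {0..1} (\<lambda>v. X (\<xi> v) \<omega>)" if "\<omega> \<in> space M" for \<omega>
    using continuous_on_compose2[OF C[rule_format, OF that] \<xi>] .
  show ?thesis
  proof
    fix v :: real assume v: "v \<in> {0..1}"
    show "X (\<xi> v) \<in> borel_measurable M" "integrable M (\<lambda>\<omega>. (X (\<xi> v) \<omega>)\<^sup>2)"
      using g[OF v v, of 1 0] centered_gaussian_moments(1)[OF g[OF v v, of 1 0]]
      by (auto simp: centered_gaussian_def)
  qed (use c gaussian_covariance_continuous[of "{0..1}" "\<lambda>v. X (\<xi> v)", OF g c] in auto)
qed

text \<open>The Riemann sums over the grid are finite linear combinations of field values and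
  converge in L^2. The factor \<open>a\<close> allows the average to be normalized into a feasible
  element.\<close>

lemma average_in_L2span:
  assumes "mean_square_process M (\<lambda>v. X (\<xi> v))" and \<xi>: "\<xi> ` {0..1} \<subseteq> T"
    and \<mu>: "\<mu> \<in> prob_measures_01"
  shows "(\<lambda>\<omega>. a * (\<integral>v. X (\<xi> v) \<omega> \<partial>\<mu>)) \<in> L2span M T X"
proof -
  interpret mean_square_process M "\<lambda>v. X (\<xi> v)" by fact
  note [measurable] = average_measurable[OF \<mu>]
  have approx: "\<exists>F c. finite F \<and> F \<subseteq> T \<and>
    (\<integral>\<omega>. (a * average \<mu> \<omega> - (\<Sum>t\<in>F. c t * X t \<omega>))\<^sup>2 \<partial>M) < \<epsilon>" if "\<epsilon> > 0" for \<epsilon>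
  proof -
    have "(\<lambda>n. a\<^sup>2 * (\<integral>\<omega>. (average \<mu> \<omega> - (\<integral>u. X (\<xi> (grid_floor n u)) \<omega> \<partial>\<mu>))\<^sup>2 \<partial>M)) \<longlonglongrightarrow> a\<^sup>2 * 0"
      by (intro tendsto_intros grid_average_tendsto \<mu>)
    then have "eventually (\<lambda>n. a\<^sup>2 * (\<integral>\<omega>. (average \<mu> \<omega> - (\<integral>u. X (\<xi> (grid_floor n u)) \<omega> \<partial>\<mu>))\<^sup>2 \<partial>M) < \<epsilon>) sequentially"
      using that by (intro order_tendstoD(2)) auto
    then obtain n where n: "a\<^sup>2 * (\<integral>\<omega>. (average \<mu> \<omega> - (\<integral>u. X (\<xi> (grid_floor n u)) \<omega> \<partial>\<mu>))\<^sup>2 \<partial>M) < \<epsilon>"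
      by (auto simp: eventually_sequentially)
    define G where "G = grid_floor n ` {0..1}"
    have fin: "finite G" unfolding G_def by (rule finite_grid_floor)
    define m where "m r = measure \<mu> {u \<in> space \<mu>. grid_floor n u = r}" for r
    \<comment> \<open>As \<open>\<xi>\<close> may send several grid points to the same
      \<open>t\<close>, the masses over each fiber are collected into one coefficient.\<close>
    define c where "c t = a * (\<Sum>r\<in>{r\<in>G. \<xi> r = t}. m r)" for t
    have "(\<Sum>t\<in>\<xi> ` G. c t * X t \<omega>) = a * (\<integral>u. X (\<xi> (grid_floor n u)) \<omega> \<partial>\<mu>)" for \<omega>
    proof -
      have "(\<integral>u. X (\<xi> (grid_floor n u)) \<omega> \<partial>\<mu>) = (\<Sum>r\<in>G. m r * X (\<xi> r) \<omega>)"
        using average_grid[OF \<mu>, of n \<omega>] by (simp add: G_def m_def)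
      also have "\<dots> = (\<Sum>t\<in>\<xi> ` G. \<Sum>r\<in>{r\<in>G. \<xi> r = t}. m r * X (\<xi> r) \<omega>)"
        by (rule sum.image_gen[OF fin])
      also have "\<dots> = (\<Sum>t\<in>\<xi> ` G. (\<Sum>r\<in>{r\<in>G. \<xi> r = t}. m r) * X t \<omega>)"
        by (intro sum.cong refl) (auto simp: sum_distrib_right)
      finally show ?thesis by (simp add: c_def mult.assoc flip: sum_distrib_left)
    qed
    then have "(\<integral>\<omega>. (a * average \<mu> \<omega> - (\<Sum>t\<in>\<xi> ` G. c t * X t \<omega>))\<^sup>2 \<partial>M) < \<epsilon>"
      using n by (simp flip: right_diff_distrib add: power_mult_distrib)
    moreover have "\<xi> ` G \<subseteq> T" using \<xi> grid_floor_in by (auto simp: G_def)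
    ultimately show ?thesis using fin by blast
  qed
  have "(\<lambda>\<omega>. a * average \<mu> \<omega>) \<in> L2span M T X"
    unfolding L2span_def using approx average_square_integrable[OF \<mu>]
    by (simp add: power_mult_distrib)
  then show ?thesis by (simp add: average_def)
qed

section \<open>Minimizing measures and the extremal feasible element\<close>

theorem theorem4p3:
  fixes M :: "'w measure" and T :: "(real ^ 'd) set"
    and X :: "real ^ 'd \<Rightarrow> 'w \<Rightarrow> real" and \<xi> :: "real \<Rightarrow> real ^ 'd"
    and H :: "'w \<Rightarrow> real"
  assumes "prob_space M"
    and "compact T"
    and "centered_gaussian_field M T X"
    and "\<forall>\<omega>\<in>space M. continuous_on T (\<lambda>t. X t \<omega>)"
    and "continuous_on {0..1} \<xi>" and "\<xi> ` {0..1} \<subseteq> T"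
    and "feasible M T X \<xi> \<noteq> {}"
    and "H \<in> feasible M T X \<xi>"
    and "(\<integral>\<omega>. (H \<omega>)\<^sup>2 \<partial>M) = CX M T X \<xi>"
  shows "(\<forall>\<mu>\<in>W_set M X \<xi>.
            AE \<omega> in M. H \<omega> = CX M T X \<xi> * (\<integral>v. X (\<xi> v) \<omega> \<partial>\<mu>))
     \<and> (\<forall>\<mu>\<in>prob_measures_01.
            \<mu> \<in> W_set M X \<xi> \<longleftrightarrow>
              ((INF v\<in>{0..1}. \<integral>u. covR M X (\<xi> u) (\<xi> v) \<partial>\<mu>) = energy M X \<xi> \<mu>
               \<and> energy M X \<xi> \<mu> > 0))"
proof -
  have ms: "mean_square_process M (\<lambda>v. X (\<xi> v))"
    using assms by (intro gaussian_field_mean_square_process)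
  interpret mean_square_process M "\<lambda>v. X (\<xi> v)" by (rule ms)
  let ?C = "CX M T X \<xi>"
  \<comment> \<open>Potential and energy become inner products in L^2; \<open>pot\<close> and
    \<open>energy\<close> below translate between the two forms.\<close>
  define g where "g \<mu> v = (\<integral>\<omega>. average \<mu> \<omega> * X (\<xi> v) \<omega> \<partial>M)" for \<mu> v
  define e where "e \<mu> = (\<integral>\<omega>. (average \<mu> \<omega>)\<^sup>2 \<partial>M)" for \<mu>
  have energy: "energy M X \<xi> \<mu> = e \<mu>" if "\<mu> \<in> prob_measures_01" for \<mu>
    unfolding energy_def covR_def e_def by (rule double_integral_cov[OF that])
  have pot: "(\<integral>u. covR M X (\<xi> u) (\<xi> v) \<partial>\<mu>) = g \<mu> v" if "\<mu> \<in> prob_measures_01" "v \<in> {0..1}" for \<mu> v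
    unfolding covR_def g_def
    using integral_average_mult(2)[OF that(1) Y_measurable[OF that(2)] Y_square_integrable[OF that(2)]]
    by simp
  have cross: "integrable \<nu> (g \<mu>)" "(\<integral>\<omega>. average \<nu> \<omega> * average \<mu> \<omega> \<partial>M) = (\<integral>v. g \<mu> v \<partial>\<nu>)"
    if "\<mu> \<in> prob_measures_01" "\<nu> \<in> prob_measures_01" for \<mu> \<nu>
    using integral_average_mult[OF that(2) average_measurable[OF that(1)] average_square_integrable[OF that(1)]]
    by (simp_all add: g_def[abs_def] mult.commute)
  have lower: "c \<le> (\<integral>v. f v \<partial>\<nu>)"
    if "\<nu> \<in> prob_measures_01" "integrable \<nu> f" "\<And>v. v \<in> {0..1} \<Longrightarrow> c \<le> f v" for \<nu> f and c :: real
  proof -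
    interpret \<nu>: prob_space \<nu> using prob_measures_01D(1)[OF that(1)] .
    show ?thesis using that prob_measures_01D(3)[OF that(1)] by (intro \<nu>.integral_ge_const) auto
  qed
  have Hm: "H \<in> borel_measurable M" and Hi: "integrable M (\<lambda>\<omega>. (H \<omega>)\<^sup>2)"
    and H1: "\<And>v. v \<in> {0..1} \<Longrightarrow> 1 \<le> (\<integral>\<omega>. X (\<xi> v) \<omega> * H \<omega> \<partial>M)"
    using assms(8) by (auto simp: feasible_def L2span_def)
  have ZH: "1 \<le> (\<integral>\<omega>. H \<omega> * average \<mu> \<omega> \<partial>M)" if "\<mu> \<in> prob_measures_01" for \<mu>
    using lower[OF that integral_average_mult(1)[OF that Hm Hi] H1] integral_average_mult(2)[OF that Hm Hi]
    by (simp add: mult.commute)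
  have C0: "0 \<le> ?C" unfolding assms(9)[symmetric] by simp
  \<comment> \<open>Expanding the square, the mixed term is controlled by \<open>ZH\<close>. The
    bound is used twice: with \<open>c = ?C + 1\<close> for positivity of the energy, and with
    \<open>c = ?C\<close> to identify \<open>H\<close>.\<close>
  have dist: "(\<integral>\<omega>. (H \<omega> - c * average \<mu> \<omega>)\<^sup>2 \<partial>M) \<le> ?C - 2 * c + c\<^sup>2 * e \<mu>"
    if "\<mu> \<in> prob_measures_01" "0 \<le> c" for \<mu> c
  proof -
    have "c * 1 \<le> c * (\<integral>\<omega>. H \<omega> * average \<mu> \<omega> \<partial>M)"
      by (intro mult_left_mono ZH that)
    then show ?thesis
      unfolding e_def square_diff_expand(2)[OF Hm average_measurable[OF that(1)] Hi average_square_integrable[OF that(1)]]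
        assms(9) by simp
  qed
  have epos: "0 < e \<mu>" if "\<mu> \<in> prob_measures_01" for \<mu>
  proof (rule ccontr)
    assume "\<not> 0 < e \<mu>"
    moreover have "0 \<le> e \<mu>" unfolding e_def by simp
    ultimately have e0: "e \<mu> = 0" by simp
    \<comment> \<open>With zero energy the bound is linear in \<open>c\<close>, and
      \<open>?C + 1\<close> is large enough to make it negative.\<close>
    have "0 \<le> (\<integral>\<omega>. (H \<omega> - (?C + 1) * average \<mu> \<omega>)\<^sup>2 \<partial>M)" by simp
    also have "\<dots> \<le> ?C - 2 * (?C + 1)" using dist[OF that, of "?C + 1"] C0 e0 by simp
    finally show False using C0 by simp
  qed
  have W: "\<mu> \<in> W_set M X \<xi> \<longleftrightarrow> (\<forall>\<nu>\<in>prob_measures_01. e \<mu> \<le> e \<nu>)" if "\<mu> \<in> prob_measures_01" for \<mu>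
    using that by (simp add: W_set_def energy)
  have Wg: "e \<mu> \<le> g \<mu> v" if "\<mu> \<in> prob_measures_01" "\<mu> \<in> W_set M X \<xi>" "v \<in> {0..1}" for \<mu> v
    using minimal_average_inner[OF that(1,3)] that(2) unfolding W[OF that(1)] e_def g_def by blast
  have part1: "AE \<omega> in M. H \<omega> = ?C * (\<integral>v. X (\<xi> v) \<omega> \<partial>\<mu>)" if \<mu>W: "\<mu> \<in> W_set M X \<xi>" for \<mu>
  proof -
    have \<mu>: "\<mu> \<in> prob_measures_01" using \<mu>W by (simp add: W_set_def)
    \<comment> \<open>The potential of a minimizer is at least \<open>e \<mu>\<close>, so dividing
      the average by \<open>e \<mu>\<close> meets the constraint level 1.\<close>
    let ?Z = "\<lambda>\<omega>. inverse (e \<mu>) * average \<mu> \<omega>"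
    have "?Z \<in> feasible M T X \<xi>"
      unfolding feasible_def
    proof (intro CollectI conjI ballI)
      show "?Z \<in> L2span M T X"
        unfolding average_def by (rule average_in_L2span[OF ms assms(6) \<mu>])
      fix v :: real assume v: "v \<in> {0..1}"
      have "(\<integral>\<omega>. X (\<xi> v) \<omega> * ?Z \<omega> \<partial>M) = inverse (e \<mu>) * g \<mu> v"
        unfolding g_def by (simp add: mult_ac flip: integral_mult_right_zero)
      then show "1 \<le> (\<integral>\<omega>. X (\<xi> v) \<omega> * ?Z \<omega> \<partial>M)"
        using Wg[OF \<mu> \<mu>W v] epos[OF \<mu>] by (simp add: field_simps)
    qed
    then have "?C \<le> (\<integral>\<omega>. (?Z \<omega>)\<^sup>2 \<partial>M)"
      unfolding CX_def by (intro cINF_lower bdd_belowI2[where m=0]) auto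
    also have "\<dots> = (inverse (e \<mu>))\<^sup>2 * e \<mu>"
      by (simp add: power_mult_distrib e_def)
    also have "\<dots> = inverse (e \<mu>)"
      using epos[OF \<mu>] by (simp add: power2_eq_square)
    finally have "?C * e \<mu> \<le> 1" using epos[OF \<mu>] by (simp add: field_simps)
    then have "?C * (?C * e \<mu>) \<le> ?C * 1" using C0 by (intro mult_left_mono)
    \<comment> \<open>With \<open>c = ?C\<close> the bound \<open>dist\<close> reads
      \<open>?C - 2 * ?C + ?C\<^sup>2 * e \<mu>\<close>, and the last term is now at most
      \<open>?C\<close>.\<close>
    then have "(\<integral>\<omega>. (H \<omega> - ?C * average \<mu> \<omega>)\<^sup>2 \<partial>M) \<le> 0"
      using dist[OF \<mu> C0] by (simp add: power2_eq_square mult.assoc)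
    then have "(\<integral>\<omega>. (H \<omega> - ?C * average \<mu> \<omega>)\<^sup>2 \<partial>M) = 0"
      by (simp add: order.antisym)
    then have "AE \<omega> in M. (H \<omega> - ?C * average \<mu> \<omega>)\<^sup>2 = 0"
      using integral_nonneg_eq_0_iff_AE[OF square_diff_expand(1)[OF Hm average_measurable[OF \<mu>]
          Hi average_square_integrable[OF \<mu>], of ?C]] by simp
    then show ?thesis by (simp add: average_def)
  qed
  have part2: "\<mu> \<in> W_set M X \<xi> \<longleftrightarrow>
      ((INF v\<in>{0..1}. \<integral>u. covR M X (\<xi> u) (\<xi> v) \<partial>\<mu>) = energy M X \<xi> \<mu> \<and> energy M X \<xi> \<mu> > 0)"
    if \<mu>: "\<mu> \<in> prob_measures_01" for \<mu>
  proof -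
    have INF: "(INF v\<in>{0..1}. \<integral>u. covR M X (\<xi> u) (\<xi> v) \<partial>\<mu>) = (INF v\<in>{0..1}. g \<mu> v)"
      by (intro INF_cong refl pot \<mu>)
    have e_cross: "e \<mu> = (\<integral>v. g \<mu> v \<partial>\<mu>)"
      using cross(2)[OF \<mu> \<mu>] by (simp add: e_def power2_eq_square)
    \<comment> \<open>An infimum of reals lies below the values only when they are bounded below.
      Here the bound comes from the nonnegative second moment of the sum of the average and
      \<open>X (\<xi> v)\<close>.\<close>
    have bdd: "bdd_below (g \<mu> ` {0..1})"
    proof -
      obtain B where B: "\<And>u v. u \<in> {0..1} \<Longrightarrow> v \<in> {0..1} \<Longrightarrow> \<bar>\<integral>\<omega>. X (\<xi> u) \<omega> * X (\<xi> v) \<omega> \<partial>M\<bar> \<le> B"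
        using cov_bounded by blast
      have "- (e \<mu> + B) \<le> g \<mu> v * 2" if v: "v \<in> {0..1}" for v
      proof -
        have "0 \<le> (\<integral>\<omega>. (average \<mu> \<omega> - (- 1) * X (\<xi> v) \<omega>)\<^sup>2 \<partial>M)" by simp
        also have "\<dots> = e \<mu> + 2 * g \<mu> v + (\<integral>\<omega>. X (\<xi> v) \<omega> * X (\<xi> v) \<omega> \<partial>M)"
          unfolding square_diff_expand(2)[OF average_measurable[OF \<mu>] Y_measurable[OF v]
              average_square_integrable[OF \<mu>] Y_square_integrable[OF v]]
          by (simp add: e_def g_def power2_eq_square)
        finally show ?thesis using B[OF v v] by simp
      qed
      then show ?thesis by (intro bdd_belowI2[where m="- (e \<mu> + B) / 2"]) simp
    qed
    show ?thesis
      unfolding INF energy[OF \<mu>]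
    proof (intro iffI conjI epos \<mu>)
      assume \<mu>W: "\<mu> \<in> W_set M X \<xi>"
      \<comment> \<open>The energy is the \<open>\<mu>\<close>-mean of the potential, so it is at
        least the infimum of the potential.\<close>
      have "(INF v\<in>{0..1}. g \<mu> v) \<le> e \<mu>"
        unfolding e_cross by (rule lower[OF \<mu> cross(1)[OF \<mu> \<mu>] cINF_lower[OF bdd]])
      moreover have "e \<mu> \<le> (INF v\<in>{0..1}. g \<mu> v)"
        using Wg[OF \<mu> \<mu>W] by (intro cINF_greatest) auto
      ultimately show "(INF v\<in>{0..1}. g \<mu> v) = e \<mu>" by simp
    next
      assume "(INF v\<in>{0..1}. g \<mu> v) = e \<mu> \<and> 0 < e \<mu>"
      then have ge: "e \<mu> \<le> g \<mu> v" if "v \<in> {0..1}" for v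
        using cINF_lower[OF bdd that] by simp
      show "\<mu> \<in> W_set M X \<xi>"
        unfolding W[OF \<mu>]
      proof
        fix \<nu> assume \<nu>: "\<nu> \<in> prob_measures_01"
        have "e \<mu> \<le> (\<integral>\<omega>. average \<nu> \<omega> * average \<mu> \<omega> \<partial>M)"
          unfolding cross(2)[OF \<mu> \<nu>] by (rule lower[OF \<nu> cross(1)[OF \<mu> \<nu>] ge])
        \<comment> \<open>Expanded, this says that twice the mutual energy is at most
          \<open>e \<nu> + e \<mu>\<close>; since the mutual energy is at least
          \<open>e \<mu>\<close>, minimality follows.\<close>
        moreover have "0 \<le> (\<integral>\<omega>. (average \<nu> \<omega> - 1 * average \<mu> \<omega>)\<^sup>2 \<partial>M)" by simp
        ultimately show "e \<mu> \<le> e \<nu>"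
          unfolding square_diff_expand(2)[OF average_measurable[OF \<nu>] average_measurable[OF \<mu>]
              average_square_integrable[OF \<nu>] average_square_integrable[OF \<mu>]]
          by (simp add: e_def)
      qed
    qed
  qed
  show ?thesis using part1 part2 by blast
qed

end
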